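(* Let $m\le n$ be positive integers, let $\mathbf U\in\mathbb C^{n\times n}$ be unitary, let $\mathbf S\in\mathbb C^{m\times n}$ be the subsampling matrix that keeps the first $m$ coordinates, let $\mathbf y\in\mathbb R^m$, and let $\lambda>0$. Let $f(\mathbf z)=\tfrac12\big\||\mathbf S\mathbf U\mathbf z|-\mathbf y\big\|^2$ for $\mathbf z\in\mathbb C^n$, and define the proximal operator of this data-fitting term by $$\operatorname{prox}_{\lambda f}(\mathbf x)=\operatorname*{arg\,min}_{\mathbf z\in\mathbb C^n}\ \tfrac12\|\mathbf z-\mathbf x\|^2+\tfrac{\lambda}{2}\big\||\mathbf S\mathbf U\mathbf z|-\mathbf y\big\|^2 .$$ Then, for $\mathbf x\in\mathbb C^n$, the proximal operator can be expressed as $$\operatorname{prox}_{\lambda f}(\mathbf x)=\mathbf U^{\mathrm H}\,\mathbf P\left(\frac{1}{1+\lambda}\mathbf U\mathbf x+\frac{\lambda}{1+\lambda}\,\tilde{\mathbf y}\odot \mathrm e^{\mathrm j\arg(\mathbf U\mathbf x)}\right)+\mathbf U^{\mathrm H}(\mathbf I-\mathbf P)\mathbf U\mathbf x,$$ where $\mathbf P=\mathbf S^{\mathrm H}\mathbf S\in\mathbb C^{n\times n}$ and $\tilde{\mathbf y}=\mathbf S^{\mathrm H}\mathbf y\in\mathbb R^n$.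
   Context: $\|\cdot\|$ is the Euclidean norm on $\mathbb C^n$ or $\mathbb C^m$; $|\cdot|$ applied to a vector is the entrywise modulus; $\odot$ is the entrywise product; $\mathrm j$ is the imaginary unit; $\arg$ (the phase of a complex number) and the exponential are applied entrywise to vectors; $^{\mathrm H}$ is the conjugate transpose; $\mathbf I$ is the $n\times n$ identity. The subsampling matrix $\mathbf S\in\mathbb C^{m\times n}$ consists of the $m\times m$ identity matrix and zeros elsewhere, i.e. $(\mathbf S\mathbf v)_k=v_k$ for $1\le k\le m$. Hence $\mathbf P=\mathbf S^{\mathrm H}\mathbf S$ is the diagonal binary mask with ones in the first $m$ diagonal positions and zeros elsewhere, and $\tilde{\mathbf y}=\mathbf S^{\mathrm H}\mathbf y$ is $\mathbf y$ padded with zeros. The setting is phase retrieval, where $\mathbf y$ is a vector of (possibly noisy) amplitude measurements of $\mathbf S\mathbf U\mathbf x$ for an unknown signal $\mathbf x$.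
   Formalization: Assumes |(Ux)_k|+λy_k ≥ 0 for k ≤ m (else the formula is no minimizer, e.g. m=n=1, U=λ=1, x=0, y=-1). With arg 0 = 0 the formula is always a minimizer; equality with the arg min set is claimed only if y_k = 0 whenever (Ux)_k = 0, k ≤ m, as otherwise minimizers are not unique. *)

theory Defs
  imports
    "HOL-Analysis.L2_Norm"
    "Jordan_Normal_Form.Schur_Decomposition"
begin

definition vec_l2norm :: "'a :: real_normed_vector vec \<Rightarrow> real" where
  "vec_l2norm v = L2_set (\<lambda>i. norm (v $ i)) {..<dim_vec v}"

definition unitary_mat :: "nat \<Rightarrow> complex mat \<Rightarrow> bool" where
  "unitary_mat n U \<longleftrightarrow>
     U \<in> carrier_mat n n \<and> mat_adjoint U * U = 1\<^sub>m n \<and> U * mat_adjoint U = 1\<^sub>m n"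

definition subsampling_mat :: "nat \<Rightarrow> nat \<Rightarrow> complex mat" where
  "subsampling_mat m n = mat m n (\<lambda>(i, j). if i = j then 1 else 0)"

definition data_fit :: "nat \<Rightarrow> nat \<Rightarrow> complex mat \<Rightarrow> real vec \<Rightarrow> complex vec \<Rightarrow> real" where
  "data_fit m n U y z =
     1 / 2 * (vec_l2norm (map_vec cmod (subsampling_mat m n *\<^sub>v (U *\<^sub>v z)) - y))\<^sup>2"

text \<open>The objective need not be convex, so the minimizer need not be unique: the proximal
  operator is the set of all minimizers.\<close>

definition prox :: "nat \<Rightarrow> (complex vec \<Rightarrow> real) \<Rightarrow> complex vec \<Rightarrow> complex vec set" where
  "prox n g x =
     {z. is_arg_min (\<lambda>z. 1 / 2 * (vec_l2norm (z - x))\<^sup>2 + g z) (\<lambda>z. z \<in> carrier_vec n) z}"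

text \<open>The entrywise \<open>e\<^sup>j\<^sup>a\<^sup>r\<^sup>g\<close>; since \<open>Arg 0 = 0\<close>, zero entries are sent to \<open>1\<close>.\<close>

definition phase_vec :: "complex vec \<Rightarrow> complex vec" where
  "phase_vec v = map_vec (\<lambda>c. exp (\<i> * complex_of_real (Arg c))) v"

end

theory Submission
  imports Defs
begin

text \<open>
  Since \<open>U\<close> is unitary, the substitution \<open>w = U z\<close> splits the objective into a sum of functions
  of the single coordinates of \<open>w\<close>. For the coordinate \<open>a\<close> of \<open>U x\<close> and a measurement \<open>t\<close>, the
  distance \<open>\<bar>w - a\<bar>\<close> is at least \<open>\<bar>\<bar>w\<bar> - \<bar>a\<bar>\<bar>\<close>, with equality for nonzero \<open>w\<close> and \<open>a\<close> iff their
  phases agree; what remains is a quadratic in \<open>\<bar>w\<bar>\<close> minimized at \<open>(\<bar>a\<bar> + \<lambda> t) / (1 + \<lambda>)\<close>, which is an admissible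
  modulus exactly when it is nonnegative.
\<close>

section \<open>Norms, adjoints and unitary invariance\<close>

lemma vec_l2norm_power2: "(vec_l2norm v)\<^sup>2 = (\<Sum>i<dim_vec v. (norm (v $ i))\<^sup>2)"
  unfolding vec_l2norm_def L2_set_def by (simp add: sum_nonneg)

lemma mat_adjoint_carrier [simp]: "A \<in> carrier_mat m n \<Longrightarrow> mat_adjoint A \<in> carrier_mat n m"
  unfolding mat_adjoint_def using cols_length[of A] by (auto simp: mat_of_rows_def)

lemma mat_adjoint_dim [simp]:
  "dim_row (mat_adjoint A) = dim_col A" "dim_col (mat_adjoint A) = dim_row A"
  unfolding mat_adjoint_def by simp_all

lemma mat_adjoint_index:
  "\<lbrakk>A \<in> carrier_mat m n; i < n; j < m\<rbrakk> \<Longrightarrow> mat_adjoint A $$ (i, j) = conjugate (A $$ (j, i))"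
  unfolding mat_adjoint_def by (auto simp: mat_of_rows_def)

lemma cscalar_prod_mult_mat_vec:
  fixes A :: "complex mat"
  assumes "A \<in> carrier_mat m n" "v \<in> carrier_vec n" "w \<in> carrier_vec m"
  shows "(A *\<^sub>v v) \<bullet>c w = v \<bullet>c (mat_adjoint A *\<^sub>v w)"
proof -
  have "(A *\<^sub>v v) \<bullet>c w = (\<Sum>i<m. \<Sum>j<n. A $$ (i, j) * v $ j * cnj (w $ i))"
    using assms
    by (auto simp: scalar_prod_def sum_distrib_right conjugate_complex_def lessThan_atLeast0
        intro!: sum.cong)
  also have "\<dots> = (\<Sum>j<n. \<Sum>i<m. A $$ (i, j) * v $ j * cnj (w $ i))"
    by (rule sum.swap)
  also have "\<dots> = v \<bullet>c (mat_adjoint A *\<^sub>v w)"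
    using assms
    by (auto simp: scalar_prod_def sum_distrib_left conjugate_complex_def lessThan_atLeast0
        mat_adjoint_index[OF assms(1)] mult_ac intro!: sum.cong)
  finally show ?thesis .
qed

lemma cscalar_prod_self:
  fixes v :: "complex vec"
  shows "v \<bullet>c v = of_real ((vec_l2norm v)\<^sup>2)"
  unfolding vec_l2norm_power2 scalar_prod_def
  by (auto simp: conjugate_complex_def lessThan_atLeast0 complex_norm_square simp del: of_real_power
      intro!: sum.cong)

lemma unitary_mat_adjoint_mult_vec:
  assumes "unitary_mat n U" "v \<in> carrier_vec n"
  shows "mat_adjoint U *\<^sub>v (U *\<^sub>v v) = v" "U *\<^sub>v (mat_adjoint U *\<^sub>v v) = v"
proof -
  have U: "U \<in> carrier_mat n n" "mat_adjoint U * U = 1\<^sub>m n" "U * mat_adjoint U = 1\<^sub>m n"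
    using assms(1) by (auto simp: unitary_mat_def)
  note A = mat_adjoint_carrier[OF U(1)]
  show "mat_adjoint U *\<^sub>v (U *\<^sub>v v) = v"
    using assoc_mult_mat_vec[OF A U(1) assms(2)] U(2) assms(2) by simp
  show "U *\<^sub>v (mat_adjoint U *\<^sub>v v) = v"
    using assoc_mult_mat_vec[OF U(1) A assms(2)] U(3) assms(2) by simp
qed

lemma vec_l2norm_unitary:
  assumes "unitary_mat n U" "v \<in> carrier_vec n"
  shows "(vec_l2norm (U *\<^sub>v v))\<^sup>2 = (vec_l2norm v)\<^sup>2"
proof -
  have U: "U \<in> carrier_mat n n"
    using assms(1) by (auto simp: unitary_mat_def)
  have "(U *\<^sub>v v) \<bullet>c (U *\<^sub>v v) = v \<bullet>c v"
    using cscalar_prod_mult_mat_vec[OF U assms(2) mult_mat_vec_carrier[OF U assms(2)]]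
      unitary_mat_adjoint_mult_vec[OF assms] by simp
  then show ?thesis
    unfolding cscalar_prod_self of_real_eq_iff .
qed

section \<open>The subsampling matrix, zero padding and the mask\<close>

lemma subsampling_mat_carrier [simp]: "subsampling_mat m n \<in> carrier_mat m n"
  by (simp add: subsampling_mat_def)

lemma subsampling_mat_mult_vec:
  assumes "m \<le> n" "v \<in> carrier_vec n" "k < m"
  shows "(subsampling_mat m n *\<^sub>v v) $ k = v $ k"
  using assms
  by (simp add: subsampling_mat_def scalar_prod_def if_distrib[of "\<lambda>c. c * _"] cong: if_cong)

lemma adjoint_subsampling_mat_mult_vec:
  assumes "m \<le> n" "v \<in> carrier_vec m" "k < n"
  shows "(mat_adjoint (subsampling_mat m n) *\<^sub>v v) $ k = (if k < m then v $ k else 0)"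
proof -
  have "(mat_adjoint (subsampling_mat m n) *\<^sub>v v) $ k
      = (\<Sum>j = 0..<m. cnj (subsampling_mat m n $$ (j, k)) * v $ j)"
    using assms carrier_matD[OF subsampling_mat_carrier[of m n]]
    by (auto simp: scalar_prod_def mat_adjoint_index[OF subsampling_mat_carrier]
        conjugate_complex_def intro!: sum.cong)
  also have "\<dots> = (\<Sum>j = 0..<m. if j = k then v $ j else 0)"
    using assms by (intro sum.cong) (auto simp: subsampling_mat_def)
  finally show ?thesis
    by simp
qed

lemma subsampling_mask_mult_vec:
  assumes "m \<le> n" "v \<in> carrier_vec n" "k < n"
  shows "(mat_adjoint (subsampling_mat m n) * subsampling_mat m n *\<^sub>v v) $ k
    = (if k < m then v $ k else 0)"
proof -
  let ?S = "subsampling_mat m n"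
  have S: "?S \<in> carrier_mat m n" by simp
  have "mat_adjoint ?S * ?S *\<^sub>v v = mat_adjoint ?S *\<^sub>v (?S *\<^sub>v v)"
    by (rule assoc_mult_mat_vec[OF mat_adjoint_carrier[OF S] S assms(2)])
  then show ?thesis
    using assms mult_mat_vec_carrier[OF S assms(2)]
    by (simp add: adjoint_subsampling_mat_mult_vec subsampling_mat_mult_vec)
qed

section \<open>The minimization problem in one measured coordinate\<close>

definition scalar_cost :: "real \<Rightarrow> complex \<Rightarrow> real \<Rightarrow> complex \<Rightarrow> real" where
  "scalar_cost lam a t w = 1 / 2 * (cmod (w - a))\<^sup>2 + lam / 2 * (cmod w - t)\<^sup>2"

definition scalar_prox :: "real \<Rightarrow> complex \<Rightarrow> real \<Rightarrow> complex" where
  "scalar_prox lam a t = complex_of_real (1 / (1 + lam)) * a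
     + complex_of_real (lam / (1 + lam)) * (complex_of_real t * exp (\<i> * complex_of_real (Arg a)))"

text \<open>Both summands are real multiples of the same unit number \<open>e\<close>. This also
  covers \<open>a = 0\<close>, where \<open>e = 1\<close>. The real factor may still be negative, so
  it need not be the modulus.\<close>

lemma scalar_prox_polar:
  assumes "0 < lam"
  shows "scalar_prox lam a t
    = complex_of_real ((cmod a + lam * t) / (1 + lam)) * exp (\<i> * complex_of_real (Arg a))"
proof -
  define e where "e = exp (\<i> * complex_of_real (Arg a))"
  have a: "a = complex_of_real (cmod a) * e"
    using rcis_cmod_Arg[of a] by (simp add: rcis_def cis_conv_exp e_def)
  have "scalar_prox lam a t = complex_of_real (1 / (1 + lam)) * (complex_of_real (cmod a) * e)
     + complex_of_real (lam / (1 + lam)) * (complex_of_real t * e)"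
    unfolding scalar_prox_def e_def[symmetric] using a by simp
  also have "\<dots> = complex_of_real ((cmod a + lam * t) / (1 + lam)) * e"
    by (simp add: add_divide_distrib algebra_simps)
  finally show ?thesis
    unfolding e_def .
qed

lemma cmod_scalar_prox:
  assumes "0 < lam" "0 \<le> cmod a + lam * t"
  shows "cmod (scalar_prox lam a t) = (cmod a + lam * t) / (1 + lam)"
proof -
  have "cmod (scalar_prox lam a t) = \<bar>(cmod a + lam * t) / (1 + lam)\<bar>"
    unfolding scalar_prox_polar[OF assms(1)] norm_mult norm_of_real by simp
  with assms show ?thesis
    by simp
qed

text \<open>This is phase alignment in a form that needs no case distinction on
  \<open>a = 0\<close>. It evaluates the real part in \<open>scalar_cost_excess\<close>, and for
  nonzero \<open>a\<close> the factor \<open>cnj a\<close> can be cancelled to recover the point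
  itself.\<close>

lemma scalar_prox_mult_cnj:
  assumes "0 < lam" "0 \<le> cmod a + lam * t"
  shows "scalar_prox lam a t * cnj a = complex_of_real (cmod (scalar_prox lam a t) * cmod a)"
proof -
  define e where "e = exp (\<i> * complex_of_real (Arg a))"
  have a: "a = complex_of_real (cmod a) * e"
    using rcis_cmod_Arg[of a] by (simp add: rcis_def cis_conv_exp e_def)
  have e: "e * cnj e = 1"
    using complex_norm_square[of e] by (simp add: e_def)
  have c: "scalar_prox lam a t = complex_of_real (cmod (scalar_prox lam a t)) * e"
    unfolding cmod_scalar_prox[OF assms] e_def by (rule scalar_prox_polar[OF assms(1)])
  have "cnj a = complex_of_real (cmod a) * cnj e"
    by (subst a) simp
  then have "scalar_prox lam a t * cnj a
      = complex_of_real (cmod (scalar_prox lam a t)) * complex_of_real (cmod a) * (e * cnj e)"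
    by (subst c) (simp add: mult_ac)
  then show ?thesis
    by (simp add: e)
qed

text \<open>Separates the mismatch of moduli from the mismatch of phases; the second summand is
  nonnegative by \<open>Re_mult_cnj_le\<close>.\<close>

lemma cmod_diff_power2:
  "(cmod (w - a))\<^sup>2 = (cmod w - cmod a)\<^sup>2 + 2 * (cmod w * cmod a - Re (w * cnj a))"
  unfolding power2_diff cmod_power2 by (simp add: algebra_simps power2_eq_square)

text \<open>Completing the square in the modulus of \<open>w\<close> gives an exact formula for the
  excess over the candidate. Both excess terms are nonnegative, so minimality and the equality case
  can be read off from it.\<close>

lemma scalar_cost_excess:
  assumes "0 < lam" "0 \<le> cmod a + lam * t"
  shows "scalar_cost lam a t w = scalar_cost lam a t (scalar_prox lam a t)
    + (1 + lam) / 2 * (cmod w - cmod (scalar_prox lam a t))\<^sup>2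
    + (cmod w * cmod a - Re (w * cnj a))"
proof -
  define r where "r = cmod (scalar_prox lam a t)"
  have "Re (scalar_prox lam a t * cnj a) = r * cmod a"
    unfolding scalar_prox_mult_cnj[OF assms] r_def by simp
  moreover have "cmod a = (1 + lam) * r - lam * t"
    using assms by (simp add: r_def cmod_scalar_prox[OF assms])
  \<comment> \<open>Since \<open>r\<close> is the vertex of the quadratic in \<open>s\<close>,
    eliminating \<open>cmod a\<close> turns the claim into a polynomial identity in
    \<open>r\<close>, \<open>s\<close>, \<open>t\<close> and \<open>lam\<close>.\<close>
  then have "(r - cmod a)\<^sup>2 + lam * (r - t)\<^sup>2 + (1 + lam) * (s - r)\<^sup>2
      = (s - cmod a)\<^sup>2 + lam * (s - t)\<^sup>2" for s
    by (simp only:) (simp add: algebra_simps power2_eq_square)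
  note this[of "cmod w"]
  ultimately show ?thesis
    unfolding scalar_cost_def cmod_diff_power2 r_def[symmetric]
    by (simp add: field_simps)
qed

lemma Re_mult_cnj_le: "Re (w * cnj a) \<le> cmod w * cmod a"
  using complex_Re_le_cmod[of "w * cnj a"] by (simp add: norm_mult)

lemma scalar_prox_minimizes:
  assumes "0 < lam" "0 \<le> cmod a + lam * t"
  shows "scalar_cost lam a t (scalar_prox lam a t) \<le> scalar_cost lam a t w"
proof -
  have "0 \<le> (1 + lam) / 2 * (cmod w - cmod (scalar_prox lam a t))\<^sup>2"
    using assms by simp
  then show ?thesis
    using scalar_cost_excess[OF assms, of w] Re_mult_cnj_le[of w a] by linarith
qed

text \<open>The third assumption excludes \<open>a = 0\<close> with \<open>t\<close> nonzero: the
  cost then depends on the modulus only, and a whole circle of points attains the minimum.\<close>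

lemma scalar_prox_unique:
  assumes "0 < lam" "0 \<le> cmod a + lam * t" "a = 0 \<longrightarrow> t = 0"
    and eq: "scalar_cost lam a t w = scalar_cost lam a t (scalar_prox lam a t)"
  shows "w = scalar_prox lam a t"
proof -
  have "0 \<le> (1 + lam) / 2 * (cmod w - cmod (scalar_prox lam a t))\<^sup>2"
    using assms by simp
  then have "(1 + lam) / 2 * (cmod w - cmod (scalar_prox lam a t))\<^sup>2 = 0"
    and re: "Re (w * cnj a) = cmod w * cmod a"
    using scalar_cost_excess[OF assms(1,2), of w] Re_mult_cnj_le[of w a] eq by linarith+
  then have mod: "cmod w = cmod (scalar_prox lam a t)"
    using assms(1) by simp
  show ?thesis
  proof (cases "a = 0")
    case True
    then show ?thesis
      using mod assms(3) by (simp add: scalar_prox_def)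
  next
    case False
    \<comment> \<open>A complex number whose real part equals its modulus is real and
      nonnegative.\<close>
    have "(Im (w * cnj a))\<^sup>2 = 0"
      using cmod_power2[of "w * cnj a"] re by (simp add: norm_mult)
    then have "w * cnj a = complex_of_real (cmod w * cmod a)"
      using re by (simp only: complex_eq_iff) simp
    then have "w * cnj a = scalar_prox lam a t * cnj a"
      using scalar_prox_mult_cnj[OF assms(1,2)] mod by simp
    with False show ?thesis
      by simp
  qed
qed

section \<open>Separation of the objective into coordinates\<close>

definition coordinate_cost :: "nat \<Rightarrow> real \<Rightarrow> complex vec \<Rightarrow> real vec \<Rightarrow> nat \<Rightarrow> complex \<Rightarrow> real" where
  "coordinate_cost m lam a y k w =
     (if k < m then scalar_cost lam (a $ k) (y $ k) w else 1 / 2 * (cmod (w - a $ k))\<^sup>2)"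

text \<open>Unitarity moves the distance term from \<open>z - x\<close> to \<open>U z - U x\<close>,
  and the data term sees only the first \<open>m\<close> entries of \<open>U z\<close>; the other
  coordinates carry the distance alone.\<close>

lemma prox_objective_eq_sum:
  assumes "m \<le> n" "unitary_mat n U" "y \<in> carrier_vec m" "x \<in> carrier_vec n" "z \<in> carrier_vec n"
  shows "1 / 2 * (vec_l2norm (z - x))\<^sup>2 + lam * data_fit m n U y z
    = (\<Sum>k<n. coordinate_cost m lam (U *\<^sub>v x) y k ((U *\<^sub>v z) $ k))"
proof -
  let ?a = "U *\<^sub>v x" and ?w = "U *\<^sub>v z"
  have U: "U \<in> carrier_mat n n"
    using assms(2) by (auto simp: unitary_mat_def)
  have a: "?a \<in> carrier_vec n" and w: "?w \<in> carrier_vec n"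
    using U assms by auto
  have "(vec_l2norm (z - x))\<^sup>2 = (vec_l2norm (?w - ?a))\<^sup>2"
    using vec_l2norm_unitary[OF assms(2), of "z - x"] assms(4,5)
      mult_minus_distrib_mat_vec[OF U assms(5,4)] by simp
  also have "\<dots> = (\<Sum>k<n. (cmod (?w $ k - ?a $ k))\<^sup>2)"
    unfolding vec_l2norm_power2 using U by (intro sum.cong) (auto simp del: index_mult_mat_vec)
  finally have dist: "(vec_l2norm (z - x))\<^sup>2 = (\<Sum>k<n. (cmod (?w $ k - ?a $ k))\<^sup>2)" .
  \<comment> \<open>Extending the data sum by zeros to all \<open>n\<close> indices lets it merge
    termwise with the distance sum.\<close>
  have "{..<m} = {..<n} \<inter> {k. k < m}"
    using assms(1) by auto
  then have "(\<Sum>k<m. (cmod (?w $ k) - y $ k)\<^sup>2)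
      = (\<Sum>k<n. if k < m then (cmod (?w $ k) - y $ k)\<^sup>2 else 0)"
    by (simp add: sum.inter_restrict)
  moreover have "(vec_l2norm (map_vec cmod (subsampling_mat m n *\<^sub>v ?w) - y))\<^sup>2
      = (\<Sum>k<m. (cmod (?w $ k) - y $ k)\<^sup>2)"
    using assms carrier_matD[OF subsampling_mat_carrier[of m n]]
    by (auto simp: vec_l2norm_power2 subsampling_mat_mult_vec[OF _ w] simp del: index_mult_mat_vec
        intro!: sum.cong)
  ultimately have fit: "lam * data_fit m n U y z
      = (\<Sum>k<n. lam / 2 * (if k < m then (cmod (?w $ k) - y $ k)\<^sup>2 else 0))"
    unfolding data_fit_def sum_distrib_left[symmetric] by simp
  show ?thesis
    unfolding dist fit coordinate_cost_def scalar_cost_def sum_distrib_left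
    by (subst sum.distrib[symmetric], intro sum.cong) auto
qed

lemma component_mult_carrier_vec:
  "\<lbrakk>v \<in> carrier_vec n; w \<in> carrier_vec n\<rbrakk> \<Longrightarrow> component_mult v w \<in> carrier_vec n"
  by (auto simp: component_mult_def)

text \<open>The sign hypothesis, automatic for nonnegative \<open>y\<close>, makes the formula
  correct: if it fails at some \<open>k\<close>, the formula gives that entry a negative multiple of
  the phase, and \<open>0\<close> would cost less there.\<close>

theorem theorem1:
  fixes m n :: nat and U :: "complex mat" and y :: "real vec" and lam :: real
    and x :: "complex vec"
  defines "S \<equiv> subsampling_mat m n"
  defines "P \<equiv> mat_adjoint S * S"
  defines "ytilde \<equiv> mat_adjoint S *\<^sub>v map_vec complex_of_real y"
  defines "p \<equiv>
      mat_adjoint U *\<^sub>v (P *\<^sub>v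
        (complex_of_real (1 / (1 + lam)) \<cdot>\<^sub>v (U *\<^sub>v x)
         + complex_of_real (lam / (1 + lam)) \<cdot>\<^sub>v component_mult ytilde (phase_vec (U *\<^sub>v x))))
      + mat_adjoint U *\<^sub>v ((1\<^sub>m n - P) *\<^sub>v (U *\<^sub>v x))"
  assumes "0 < m" and "m \<le> n"
    and "unitary_mat n U"
    and "y \<in> carrier_vec m"
    and "0 < lam"
    and "x \<in> carrier_vec n"
    and "\<forall>k<m. 0 \<le> cmod ((U *\<^sub>v x) $ k) + lam * y $ k"
  shows "p \<in> prox n (\<lambda>z. lam * data_fit m n U y z) x \<and>
    ((\<forall>k<m. (U *\<^sub>v x) $ k = 0 \<longrightarrow> y $ k = 0) \<longrightarrow>
       prox n (\<lambda>z. lam * data_fit m n U y z) x = {p})"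
proof -
  define a where "a = U *\<^sub>v x"
  \<comment> \<open>The candidate in the transformed coordinates, \<open>b = U p\<close>, obtained
    by factoring the adjoint of \<open>U\<close> out of the formula.\<close>
  define b where "b = P *\<^sub>v
        (complex_of_real (1 / (1 + lam)) \<cdot>\<^sub>v a
         + complex_of_real (lam / (1 + lam)) \<cdot>\<^sub>v component_mult ytilde (phase_vec a))
      + (1\<^sub>m n - P) *\<^sub>v a"
  define q where "q = coordinate_cost m lam a y"
  note [simp] = \<open>0 < lam\<close>
  have U: "U \<in> carrier_mat n n" and UH: "mat_adjoint U \<in> carrier_mat n n"
    using \<open>unitary_mat n U\<close> by (auto simp: unitary_mat_def)
  have S: "S \<in> carrier_mat m n" and SH: "mat_adjoint S \<in> carrier_mat n m"
    and P: "P \<in> carrier_mat n n"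
    unfolding P_def S_def by (auto intro!: mult_carrier_mat[of _ n m])
  have a: "a \<in> carrier_vec n"
    unfolding a_def using U \<open>x \<in> carrier_vec n\<close> by simp
  have ph: "phase_vec a \<in> carrier_vec n"
    using a by (simp add: phase_vec_def)
  have yt: "ytilde \<in> carrier_vec n"
    unfolding ytilde_def using SH \<open>y \<in> carrier_vec m\<close> by simp
  have yph: "component_mult ytilde (phase_vec a) \<in> carrier_vec n"
    by (rule component_mult_carrier_vec[OF yt ph])
  define v where "v = complex_of_real (1 / (1 + lam)) \<cdot>\<^sub>v a
         + complex_of_real (lam / (1 + lam)) \<cdot>\<^sub>v component_mult ytilde (phase_vec a)"
  have v: "v \<in> carrier_vec n"
    unfolding v_def using a yph by simp
  have b: "b \<in> carrier_vec n"
    unfolding b_def v_def[symmetric] using P v a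
    by (intro add_carrier_vec mult_mat_vec_carrier[of _ n n] minus_carrier_mat)
  have "p = mat_adjoint U *\<^sub>v b"
    unfolding p_def b_def a_def[symmetric] v_def[symmetric]
    using mult_add_distrib_mat_vec[OF UH, of "P *\<^sub>v v" "(1\<^sub>m n - P) *\<^sub>v a"] P v a
      mult_mat_vec_carrier[OF minus_carrier_mat[OF P] a] by simp
  then have p: "p \<in> carrier_vec n" and Up: "U *\<^sub>v p = b"
    using UH b unitary_mat_adjoint_mult_vec(2)[OF \<open>unitary_mat n U\<close> b] by auto
  have v_index: "v $ k = scalar_prox lam (a $ k) (y $ k)" if "k < m" for k
  proof -
    have k: "k < n" using that \<open>m \<le> n\<close> by simp
    have "ytilde $ k = complex_of_real (y $ k)"
      unfolding ytilde_def S_def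
      using adjoint_subsampling_mat_mult_vec[OF \<open>m \<le> n\<close> _ k, of "map_vec complex_of_real y"]
        that \<open>y \<in> carrier_vec m\<close> by auto
    then show ?thesis
      using k a ph yt yph
      by (simp add: v_def scalar_prox_def index_component_mult phase_vec_def carrier_vecD)
  qed
  \<comment> \<open>The mask selects \<open>v\<close> on measured coordinates and its complement
    selects \<open>a\<close> on the others, so each entry of \<open>b\<close> is the candidate for
    its own coordinate problem.\<close>
  have b_index: "b $ k = (if k < m then scalar_prox lam (a $ k) (y $ k) else a $ k)"
    if "k < n" for k
  proof -
    have "(1\<^sub>m n - P) *\<^sub>v a = a - P *\<^sub>v a"
      using minus_mult_distrib_mat_vec[OF one_carrier_mat P a] a by simp
    then have "b $ k = (P *\<^sub>v v) $ k + (a $ k - (P *\<^sub>v a) $ k)"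
      unfolding b_def v_def[symmetric] using P a that by simp
    then show ?thesis
      unfolding P_def S_def
      using subsampling_mask_mult_vec[OF \<open>m \<le> n\<close> v that]
        subsampling_mask_mult_vec[OF \<open>m \<le> n\<close> a that] v_index by simp
  qed
  have nonneg: "0 \<le> cmod (a $ k) + lam * y $ k" if "k < m" for k
    using assms(11) that by (simp add: a_def)
  have q_min: "q k (b $ k) \<le> q k w" if "k < n" for k w
    using that nonneg by (simp add: q_def coordinate_cost_def b_index scalar_prox_minimizes)
  let ?J = "\<lambda>z. 1 / 2 * (vec_l2norm (z - x))\<^sup>2 + lam * data_fit m n U y z"
  have J: "?J z = (\<Sum>k<n. q k ((U *\<^sub>v z) $ k))" if "z \<in> carrier_vec n" for z
    unfolding q_def a_def
    using prox_objective_eq_sum[OF \<open>m \<le> n\<close> \<open>unitary_mat n U\<close> \<open>y \<in> carrier_vec m\<close>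
        \<open>x \<in> carrier_vec n\<close> that] .
  have J_min: "?J p \<le> ?J z" if "z \<in> carrier_vec n" for z
    unfolding J[OF p] J[OF that] Up by (intro sum_mono q_min) simp
  have mem: "p \<in> prox n (\<lambda>z. lam * data_fit m n U y z) x"
    unfolding prox_def mem_Collect_eq is_arg_min_linorder using p J_min by blast
  have "z = p" if phase: "\<forall>k<m. a $ k = 0 \<longrightarrow> y $ k = 0"
    and z: "z \<in> prox n (\<lambda>z. lam * data_fit m n U y z) x" for z
  proof -
    have zc: "z \<in> carrier_vec n" and "?J z \<le> ?J p"
      using z p unfolding prox_def mem_Collect_eq is_arg_min_linorder by blast+
    then have "?J p = ?J z"
      using J_min[OF zc] by linarith
    then have sums: "(\<Sum>k<n. q k (b $ k)) = (\<Sum>k<n. q k ((U *\<^sub>v z) $ k))"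
      unfolding J[OF p] J[OF zc] Up .
    have "(U *\<^sub>v z) $ k = b $ k" if k: "k < n" for k
    proof -
      \<comment> \<open>Termwise inequalities between equal sums are equalities, so uniqueness can
        be applied in each coordinate; on an unmeasured one, zero distance forces the entry of
        \<open>a\<close>.\<close>
      have "q k (b $ k) = q k ((U *\<^sub>v z) $ k)"
        by (rule sum_mono_inv[OF sums]) (use k q_min in auto)
      then show ?thesis
        using k scalar_prox_unique[OF \<open>0 < lam\<close> nonneg] phase
        by (auto simp: q_def coordinate_cost_def b_index split: if_splits)
    qed
    then have "U *\<^sub>v z = b"
      using b U by (intro eq_vecI) auto
    then show "z = p"
      using unitary_mat_adjoint_mult_vec(1)[OF \<open>unitary_mat n U\<close> zc]
        \<open>p = mat_adjoint U *\<^sub>v b\<close> by simp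
  qed
  with mem show ?thesis
    unfolding a_def by blast
qed

end
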